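(* Let $d\ge1$ and $I_1,\dots,I_d\ge1$ be integers, $L=I_1I_2\cdots I_d$, $1\le N<L$, and let $\mathcal{X}_{\cdot,1},\dots,\mathcal{X}_{\cdot,N}$ be tensors in $\mathbb{R}^{I_1\times\cdots\times I_d}$ spanning a subspace of dimension $r$. Let $\sum_{\mathbf{i}}\mathcal{X}_{\mathbf{i},m}\mathcal{X}_{\mathbf{i},n}=\sum_{p=1}^{r}U_{m,p}\,\sigma_p^2\,U_{n,p}$ with $\sigma_p>0$ and $U$ an $N\times r$ matrix with orthonormal columns, and let $\mathcal{Q}_{\mathbf{i},l}=\sum_{n=1}^{N}\mathcal{X}_{\mathbf{i},n}U_{n,l}\sigma_l^{-1}$, $l=1,\dots,r$. For $1\le M<r$ let $$\hat{\mathcal{X}}_{\mathbf{i},n}=\sum_{l=1}^{M}\mathcal{Q}_{\mathbf{i},l}\,U_{n,l}\,\sigma_l,\qquad n=1,\dots,N.$$ Then $$\mathcal{E}=\sum_{n=1}^{N}\sum_{\mathbf{i}}\bigl(\mathcal{X}_{\mathbf{i},n}-\hat{\mathcal{X}}_{\mathbf{i},n}\bigr)^2=\sum_{p=M+1}^{r}\sigma_p^2 ,$$ and, among all orderings of the $r$ components, this error is minimum when $\sigma_{M+1},\dots,\sigma_r$ are the lowest singular values, equivalently when the $M$ retained components correspond to the highest singular values.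
   Context: An order-$d$ tensor in $\mathbb{R}^{I_1\times\cdots\times I_d}$ is a real array with entries indexed by multi-indices $\mathbf{i}=(i_1,\dots,i_d)$, $1\le i_k\le I_k$; $\mathcal{X}_{\mathbf{i},n}$ is the $\mathbf{i}$ entry of the $n$-th tensor $\mathcal{X}_{\cdot,n}$. The numbers $\sigma_1,\dots,\sigma_r$ are called the singular values of the dataset. *)

theory Defs
  imports Complex_Main "HOL-Library.FuncSet" "HOL-Library.Function_Algebras"
    "HOL-Combinatorics.Permutations"
begin

definition multi_indices :: "nat \<Rightarrow> (nat \<Rightarrow> nat) \<Rightarrow> (nat \<Rightarrow> nat) set" where
  "multi_indices d I = (\<Pi>\<^sub>E k\<in>{1..d}. {1..I k})"

text \<open>A tensor is a total function on multi-indices. Extending it by zero outside the index box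
  makes equality of functions agree with equality of arrays.\<close>

type_synonym tensor = "(nat \<Rightarrow> nat) \<Rightarrow> real"

definition tensors :: "nat \<Rightarrow> (nat \<Rightarrow> nat) \<Rightarrow> tensor set" where
  "tensors d I = {T. \<forall>i. i \<notin> multi_indices d I \<longrightarrow> T i = 0}"

definition tensor_scale :: "real \<Rightarrow> tensor \<Rightarrow> tensor" where
  "tensor_scale c T = (\<lambda>i. c * T i)"

text \<open>Provides \<open>tensor.span\<close> and \<open>tensor.dim\<close>; addition of functions is pointwise.\<close>

global_interpretation tensor: vector_space tensor_scale
  by unfold_locales (auto simp: tensor_scale_def algebra_simps)

text \<open>In a dataset \<open>X\<close>, the \<open>n\<close>-th tensor is \<open>X n\<close> and its \<open>i\<close> entry is \<open>X n i\<close>.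
  Matrices are functions of a row and a column index, both starting at 1.\<close>

definition left_tensor ::
  "nat \<Rightarrow> (nat \<Rightarrow> tensor) \<Rightarrow> (nat \<Rightarrow> nat \<Rightarrow> real) \<Rightarrow> (nat \<Rightarrow> real) \<Rightarrow> nat \<Rightarrow> tensor" where
  "left_tensor N X U \<sigma> l i = (\<Sum>n=1..N. X n i * U n l * inverse (\<sigma> l))"

definition truncation ::
  "nat \<Rightarrow> (nat \<Rightarrow> tensor) \<Rightarrow> (nat \<Rightarrow> nat \<Rightarrow> real) \<Rightarrow> (nat \<Rightarrow> real) \<Rightarrow> nat \<Rightarrow> nat \<Rightarrow> tensor" where
  "truncation N X U \<sigma> M n i = (\<Sum>l=1..M. left_tensor N X U \<sigma> l i * U n l * \<sigma> l)"

definition truncation_error ::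
  "nat \<Rightarrow> (nat \<Rightarrow> nat) \<Rightarrow> nat \<Rightarrow> (nat \<Rightarrow> tensor) \<Rightarrow> (nat \<Rightarrow> nat \<Rightarrow> real) \<Rightarrow> (nat \<Rightarrow> real) \<Rightarrow> nat \<Rightarrow> real"
where
  "truncation_error d I N X U \<sigma> M =
    (\<Sum>n=1..N. \<Sum>i\<in>multi_indices d I. (X n i - truncation N X U \<sigma> M n i)\<^sup>2)"

text \<open>The error when component \<open>\<pi> l\<close> is moved to position \<open>l\<close>, so that the components
  \<open>\<pi> 1, \<dots>, \<pi> M\<close> are retained.\<close>

definition reordered_error ::
  "nat \<Rightarrow> (nat \<Rightarrow> nat) \<Rightarrow> nat \<Rightarrow> (nat \<Rightarrow> tensor) \<Rightarrow> (nat \<Rightarrow> nat \<Rightarrow> real) \<Rightarrow> (nat \<Rightarrow> real) \<Rightarrow> nat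
    \<Rightarrow> (nat \<Rightarrow> nat) \<Rightarrow> real"
where
  "reordered_error d I N X U \<sigma> M \<pi> =
    truncation_error d I N X (\<lambda>n l. U n (\<pi> l)) (\<lambda>l. \<sigma> (\<pi> l)) M"

text \<open>Singular values may repeat, so these predicates on a set of components \<open>S\<close> compare with
  \<open>\<le>\<close>; \<open>S\<close> is then a choice of \<open>card S\<close> lowest (highest) among the \<open>r\<close> values.\<close>

definition has_lowest :: "nat \<Rightarrow> (nat \<Rightarrow> real) \<Rightarrow> nat set \<Rightarrow> bool" where
  "has_lowest r \<sigma> S \<longleftrightarrow> (\<forall>p\<in>S. \<forall>q\<in>{1..r} - S. \<sigma> p \<le> \<sigma> q)"

definition has_highest :: "nat \<Rightarrow> (nat \<Rightarrow> real) \<Rightarrow> nat set \<Rightarrow> bool" where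
  "has_highest r \<sigma> S \<longleftrightarrow> (\<forall>p\<in>S. \<forall>q\<in>{1..r} - S. \<sigma> q \<le> \<sigma> p)"

end

(* Truncating to the first M components multiplies the N data vectors by the orthogonal projection
   P = U_M U_M^T, where U_M consists of the first M columns of U. The error is therefore the trace
   of (1 - P) G (1 - P), where G = U diag(sigma^2) U^T is the Gram matrix, and 1 - P annihilates the
   first M columns of U and fixes the others. Reordering the components preserves the hypotheses, so
   the optimality claim reduces to comparing sums of squares over subsets of {1..r} of equal size. *)

theory Submission
  imports Defs
begin

text \<open>The factor \<open>\<sigma> l\<close> cancels the \<open>inverse (\<sigma> l)\<close>
  hidden in \<open>left_tensor\<close>. What remains is linear in the data, with coefficients given
  by column \<open>n\<close> of 1 - P.\<close>

lemma truncation_residual: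
  fixes \<sigma> :: "nat \<Rightarrow> real"
  assumes "n \<in> {1..N}" and "\<forall>l\<in>{1..M}. \<sigma> l \<noteq> 0"
  shows "X n i - truncation N X U \<sigma> M n i
    = (\<Sum>m=1..N. X m i * ((if m = n then 1 else 0) - (\<Sum>l=1..M. U m l * U n l)))"
proof -
  have "truncation N X U \<sigma> M n i = (\<Sum>l=1..M. \<Sum>m=1..N. X m i * (U m l * U n l))"
    unfolding truncation_def left_tensor_def sum_distrib_right
    using assms(2) by (intro sum.cong refl) simp
  also have "\<dots> = (\<Sum>m=1..N. X m i * (\<Sum>l=1..M. U m l * U n l))"
    by (subst sum.swap) (simp add: sum_distrib_left)
  finally have "truncation N X U \<sigma> M n i = \<dots>" .
  \<comment> \<open>Expanding \<open>X n i\<close> against a Kronecker delta lets the two sums over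
    \<open>m\<close> be subtracted termwise.\<close>
  moreover have "(\<Sum>m=1..N. X m i * (if m = n then 1 else 0)) = X n i"
    using assms(1) by (simp add: if_distrib cong: if_cong)
  ultimately show ?thesis
    by (simp only: right_diff_distrib sum_subtractf)
qed

text \<open>By orthonormality, P fixes each of the first \<open>M\<close> columns of
  \<open>U\<close> and annihilates the others, so 1 - P does the opposite. This is read off entry by
  entry, at row \<open>n\<close>.\<close>

lemma residual_times_column:
  fixes U :: "nat \<Rightarrow> nat \<Rightarrow> real"
  assumes orth: "\<forall>p\<in>{1..r}. \<forall>q\<in>{1..r}. (\<Sum>n=1..N. U n p * U n q) = (if p = q then 1 else 0)"
    and "M \<le> r" and "n \<in> {1..N}" and "p \<in> {1..r}"
  shows "(\<Sum>m=1..N. ((if m = n then 1 else 0) - (\<Sum>l=1..M. U m l * U n l)) * U m p)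
    = (if p \<le> M then 0 else U n p)"
proof -
  have "(\<Sum>m=1..N. (\<Sum>l=1..M. U m l * U n l) * U m p)
      = (\<Sum>l=1..M. \<Sum>m=1..N. U n l * (U m l * U m p))"
    unfolding sum_distrib_right by (subst sum.swap) (simp add: ac_simps)
  also have "\<dots> = (\<Sum>l=1..M. U n l * (if l = p then 1 else 0))"
    unfolding sum_distrib_left[symmetric] using orth assms(2,4) by (intro sum.cong refl) auto
  also have "\<dots> = (if p \<le> M then U n p else 0)"
    using assms(4) by (simp add: if_distrib cong: if_cong)
  finally have "(\<Sum>m=1..N. (\<Sum>l=1..M. U m l * U n l) * U m p) = \<dots>" .
  moreover have "(\<Sum>m=1..N. (if m = n then 1 else 0) * U m p) = U n p"
    using assms(3) by (simp add: if_distrib[of "\<lambda>x. x * _"] cong: if_cong)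
  ultimately show ?thesis
    by (simp only: left_diff_distrib sum_subtractf) simp
qed

text \<open>Both sides are the quadratic form c^T G c of the Gram matrix G: on the left through the
  data, on the right through the factorization of G, which turns it into a weighted sum of
  squares.\<close>

lemma sum_power2_gram:
  fixes X :: "'a \<Rightarrow> 'i \<Rightarrow> real"
  assumes gram: "\<forall>m\<in>A. \<forall>n\<in>A. (\<Sum>i\<in>J. X m i * X n i) = (\<Sum>p\<in>B. U m p * (\<sigma> p)\<^sup>2 * U n p)"
  shows "(\<Sum>i\<in>J. (\<Sum>m\<in>A. X m i * c m)\<^sup>2) = (\<Sum>p\<in>B. (\<sigma> p)\<^sup>2 * (\<Sum>m\<in>A. c m * U m p)\<^sup>2)"
proof -
  have "(\<Sum>i\<in>J. (\<Sum>m\<in>A. X m i * c m)\<^sup>2) = (\<Sum>i\<in>J. \<Sum>m\<in>A. \<Sum>n\<in>A. c m * c n * (X m i * X n i))"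
    by (simp add: power2_eq_square sum_product ac_simps)
  also have "\<dots> = (\<Sum>m\<in>A. \<Sum>n\<in>A. c m * c n * (\<Sum>i\<in>J. X m i * X n i))"
    unfolding sum_distrib_left by (subst sum.swap, intro sum.cong refl, rule sum.swap)
  also have "\<dots> = (\<Sum>m\<in>A. \<Sum>n\<in>A. c m * c n * (\<Sum>p\<in>B. U m p * (\<sigma> p)\<^sup>2 * U n p))"
    using gram by simp
  also have "\<dots> = (\<Sum>p\<in>B. \<Sum>m\<in>A. \<Sum>n\<in>A. c m * c n * (U m p * (\<sigma> p)\<^sup>2 * U n p))"
    unfolding sum_distrib_left
    \<comment> \<open>The instantiation directs the rewriting to the outer sums over
      \<open>p\<close> and \<open>m\<close> on the right-hand side; the inner swap of
      \<open>n\<close> and \<open>p\<close> then closes the goal.\<close>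
    by (subst sum.swap[where B = A and A = B], intro sum.cong refl, rule sum.swap)
  also have "\<dots> = (\<Sum>p\<in>B. (\<sigma> p)\<^sup>2 * (\<Sum>m\<in>A. c m * U m p)\<^sup>2)"
    by (simp add: power2_eq_square sum_product sum_distrib_left ac_simps)
  finally show ?thesis .
qed

text \<open>For each \<open>n\<close> the squared residual is the quadratic form of G at column
  \<open>n\<close> of 1 - P. Summing over \<open>n\<close> leaves each discarded
  \<open>(\<sigma> p)\<^sup>2\<close> times the squared norm of column \<open>p\<close> of
  \<open>U\<close>, which is 1.\<close>

lemma truncation_error_eq:
  fixes \<sigma> :: "nat \<Rightarrow> real"
  assumes gram: "\<forall>m\<in>{1..N}. \<forall>n\<in>{1..N}.
      (\<Sum>i\<in>multi_indices d I. X m i * X n i) = (\<Sum>p=1..r. U m p * (\<sigma> p)\<^sup>2 * U n p)"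
    and pos: "\<forall>p\<in>{1..r}. \<sigma> p > 0"
    and orth: "\<forall>p\<in>{1..r}. \<forall>q\<in>{1..r}. (\<Sum>n=1..N. U n p * U n q) = (if p = q then 1 else 0)"
    and "M \<le> r"
  shows "truncation_error d I N X U \<sigma> M = (\<Sum>p=M+1..r. (\<sigma> p)\<^sup>2)"
proof -
  have nz: "\<forall>l\<in>{1..M}. \<sigma> l \<noteq> 0"
    using pos \<open>M \<le> r\<close> by force
  have "truncation_error d I N X U \<sigma> M
      = (\<Sum>n=1..N. \<Sum>p=1..r. (\<sigma> p)\<^sup>2 * (if p \<le> M then 0 else U n p)\<^sup>2)"
    unfolding truncation_error_def
  proof (intro sum.cong refl)
    fix n assume n: "n \<in> {1..N}"
    show "(\<Sum>i\<in>multi_indices d I. (X n i - truncation N X U \<sigma> M n i)\<^sup>2)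
        = (\<Sum>p=1..r. (\<sigma> p)\<^sup>2 * (if p \<le> M then 0 else U n p)\<^sup>2)"
      unfolding truncation_residual[OF n nz] sum_power2_gram[OF gram]
      by (intro sum.cong refl) (simp only: residual_times_column[OF orth \<open>M \<le> r\<close> n])
  qed
  also have "\<dots> = (\<Sum>p=1..r. \<Sum>n=1..N. (\<sigma> p)\<^sup>2 * (if p \<le> M then 0 else U n p)\<^sup>2)"
    by (rule sum.swap)
  also have "\<dots> = (\<Sum>p=1..r. if p \<le> M then 0 else (\<sigma> p)\<^sup>2)"
    using orth
    by (intro sum.cong refl) (simp add: power2_eq_square flip: sum_distrib_left)
  also have "\<dots> = (\<Sum>p=M+1..r. (\<sigma> p)\<^sup>2)"
    by (rule sum.mono_neutral_cong_right) auto
  finally show ?thesis .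
qed

text \<open>Permuting the columns of \<open>U\<close> together with \<open>\<sigma>\<close> only
  reindexes the Gram sum and keeps positivity and, by injectivity of \<open>\<pi>\<close>,
  orthonormality. Hence the error formula applies to the reordered components.\<close>

lemma reordered_error_eq:
  fixes \<sigma> :: "nat \<Rightarrow> real"
  assumes gram: "\<forall>m\<in>{1..N}. \<forall>n\<in>{1..N}.
      (\<Sum>i\<in>multi_indices d I. X m i * X n i) = (\<Sum>p=1..r. U m p * (\<sigma> p)\<^sup>2 * U n p)"
    and pos: "\<forall>p\<in>{1..r}. \<sigma> p > 0"
    and orth: "\<forall>p\<in>{1..r}. \<forall>q\<in>{1..r}. (\<Sum>n=1..N. U n p * U n q) = (if p = q then 1 else 0)"
    and "M \<le> r" and perm: "\<pi> permutes {1..r}"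
  shows "reordered_error d I N X U \<sigma> M \<pi> = (\<Sum>p\<in>\<pi> ` {M+1..r}. (\<sigma> p)\<^sup>2)"
proof -
  have mem: "\<pi> p \<in> {1..r}" if "p \<in> {1..r}" for p
    using that permutes_in_image[OF perm] by simp
  have "reordered_error d I N X U \<sigma> M \<pi> = (\<Sum>p=M+1..r. (\<sigma> (\<pi> p))\<^sup>2)"
    unfolding reordered_error_def
  proof (rule truncation_error_eq)
    show "\<forall>m\<in>{1..N}. \<forall>n\<in>{1..N}. (\<Sum>i\<in>multi_indices d I. X m i * X n i)
        = (\<Sum>p=1..r. U m (\<pi> p) * (\<sigma> (\<pi> p))\<^sup>2 * U n (\<pi> p))"
      using gram sum.permute[OF perm, where g = "\<lambda>p. U m p * (\<sigma> p)\<^sup>2 * U n p" for m n]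
      by (simp add: o_def)
    show "\<forall>p\<in>{1..r}. \<sigma> (\<pi> p) > 0"
      using pos mem by blast
    show "\<forall>p\<in>{1..r}. \<forall>q\<in>{1..r}.
        (\<Sum>n=1..N. U n (\<pi> p) * U n (\<pi> q)) = (if p = q then 1 else 0)"
      using orth mem by (auto simp: inj_eq[OF permutes_inj[OF perm]])
  qed (fact \<open>M \<le> r\<close>)
  \<comment> \<open>In this form the error depends only on the set of discarded components, not on
    their order.\<close>
  also have "\<dots> = (\<Sum>p\<in>\<pi> ` {M+1..r}. (\<sigma> p)\<^sup>2)"
    by (simp add: sum.reindex[OF permutes_inj_on[OF perm]] o_def)
  finally show ?thesis .
qed

text \<open>An exchange argument: the common part of \<open>S\<close> and \<open>T\<close>
  contributes equally, and the two differences, having equal size, are matched by a bijection along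
  which \<open>f\<close> does not decrease.\<close>

lemma sum_le_sum_of_card_eq:
  fixes f :: "'a \<Rightarrow> 'b :: ordered_comm_monoid_add"
  assumes "finite S" and "finite T" and "card S = card T"
    and le: "\<And>p q. p \<in> S - T \<Longrightarrow> q \<in> T - S \<Longrightarrow> f p \<le> f q"
  shows "sum f S \<le> sum f T"
proof -
  have "card (S - T) = card (T - S)"
    using assms(1-3) by (simp add: card_Diff_subset_Int Int_commute)
  then obtain h where h: "bij_betw h (S - T) (T - S)"
    using assms(1,2) finite_same_card_bij by blast
  have "sum f (S - T) \<le> (\<Sum>p\<in>S - T. f (h p))"
    using h by (intro sum_mono le) (auto dest: bij_betwE)
  also have "\<dots> = sum f (T - S)"
    by (rule sum.reindex_bij_betw[OF h])
  finally have "sum f (S \<inter> T) + sum f (S - T) \<le> sum f (T \<inter> S) + sum f (T - S)"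
    by (simp add: Int_commute add_left_mono)
  then show ?thesis
    using sum.Int_Diff[OF assms(1), of f T] sum.Int_Diff[OF assms(2), of f S] by simp
qed

theorem mainTheorem6:
  fixes d L N r M :: nat and I :: "nat \<Rightarrow> nat"
    and X :: "nat \<Rightarrow> tensor"
    and U :: "nat \<Rightarrow> nat \<Rightarrow> real" and \<sigma> :: "nat \<Rightarrow> real"
  assumes "1 \<le> d"
    and "\<forall>k\<in>{1..d}. 1 \<le> I k"
    and "L = (\<Prod>k=1..d. I k)"
    and "1 \<le> N" and "N < L"
    and "\<forall>n\<in>{1..N}. X n \<in> tensors d I"
    and "tensor.dim (tensor.span (X ` {1..N})) = r"
    and "\<forall>m\<in>{1..N}. \<forall>n\<in>{1..N}.
      (\<Sum>i\<in>multi_indices d I. X m i * X n i) = (\<Sum>p=1..r. U m p * (\<sigma> p)\<^sup>2 * U n p)"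
    and "\<forall>p\<in>{1..r}. \<sigma> p > 0"
    and "\<forall>p\<in>{1..r}. \<forall>q\<in>{1..r}. (\<Sum>n=1..N. U n p * U n q) = (if p = q then 1 else 0)"
    and "1 \<le> M" and "M < r"
  shows "truncation_error d I N X U \<sigma> M = (\<Sum>p=M+1..r. (\<sigma> p)\<^sup>2)
    \<and> (\<forall>\<pi>. \<pi> permutes {1..r} \<longrightarrow>
        (has_lowest r \<sigma> (\<pi> ` {M+1..r}) \<longleftrightarrow> has_highest r \<sigma> (\<pi> ` {1..M}))
        \<and> (has_lowest r \<sigma> (\<pi> ` {M+1..r}) \<longrightarrow>
            is_arg_min (reordered_error d I N X U \<sigma> M) (\<lambda>\<rho>. \<rho> permutes {1..r}) \<pi>))"
proof -
  note hyps = assms(8-10) less_imp_le[OF \<open>M < r\<close>]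
  have opt: "(has_lowest r \<sigma> (\<pi> ` {M+1..r}) \<longleftrightarrow> has_highest r \<sigma> (\<pi> ` {1..M}))
        \<and> (has_lowest r \<sigma> (\<pi> ` {M+1..r}) \<longrightarrow>
            is_arg_min (reordered_error d I N X U \<sigma> M) (\<lambda>\<rho>. \<rho> permutes {1..r}) \<pi>)"
    if \<pi>: "\<pi> permutes {1..r}" for \<pi>
  proof (intro conjI impI)
    \<comment> \<open>Retained and discarded components are complementary in \<open>{1..r}\<close>,
      also after applying \<open>\<pi>\<close>, so both predicates compare the same pairs.\<close>
    have "{1..r} - {1..M} = {M+1..r}" "{1..r} - {M+1..r} = {1..M}"
      using \<open>M < r\<close> by auto
    then have "{1..r} - \<pi> ` {1..M} = \<pi> ` {M+1..r}" "{1..r} - \<pi> ` {M+1..r} = \<pi> ` {1..M}"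
      using image_set_diff[OF permutes_inj[OF \<pi>]] permutes_image[OF \<pi>] by metis+
    then show "has_lowest r \<sigma> (\<pi> ` {M+1..r}) \<longleftrightarrow> has_highest r \<sigma> (\<pi> ` {1..M})"
      unfolding has_lowest_def has_highest_def by auto
    assume low: "has_lowest r \<sigma> (\<pi> ` {M+1..r})"
    have "reordered_error d I N X U \<sigma> M \<pi> \<le> reordered_error d I N X U \<sigma> M \<rho>"
      if \<rho>: "\<rho> permutes {1..r}" for \<rho>
      unfolding reordered_error_eq[OF hyps \<pi>] reordered_error_eq[OF hyps \<rho>]
    proof (rule sum_le_sum_of_card_eq)
      show "card (\<pi> ` {M+1..r}) = card (\<rho> ` {M+1..r})"
        by (simp add: card_image permutes_inj_on[OF \<pi>] permutes_inj_on[OF \<rho>])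
      fix p q
      assume "p \<in> \<pi> ` {M+1..r} - \<rho> ` {M+1..r}" "q \<in> \<rho> ` {M+1..r} - \<pi> ` {M+1..r}"
      \<comment> \<open>The inclusions place \<open>q\<close> among the components retained by
        \<open>\<pi>\<close>, where \<open>has_lowest\<close> gives the comparison with
        \<open>p\<close>.\<close>
      moreover have "\<pi> ` {M+1..r} \<subseteq> {1..r}" "\<rho> ` {M+1..r} \<subseteq> {1..r}"
        using permutes_image[OF \<pi>] permutes_image[OF \<rho>] by force+
      ultimately have "p \<in> {1..r}" "\<sigma> p \<le> \<sigma> q"
        using low unfolding has_lowest_def by blast+
      \<comment> \<open>Squaring preserves the order because \<open>\<sigma> p\<close> is
        positive.\<close>
      then show "(\<sigma> p)\<^sup>2 \<le> (\<sigma> q)\<^sup>2"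
        using assms(9) by (intro power_mono) (auto intro: less_imp_le)
    qed auto
    then show "is_arg_min (reordered_error d I N X U \<sigma> M) (\<lambda>\<rho>. \<rho> permutes {1..r}) \<pi>"
      using \<pi> by (simp add: is_arg_min_linorder)
  qed
  show ?thesis
    using truncation_error_eq[OF hyps] opt by blast
qed

end
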